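(* There exist an absolute constant $c > 0$ and a sequence $q = (q_n)_{n \geq 0}$ with $q_n \in \{-1,+1\}$ for all $n$ ($q$ not depending on $\epsilon$) such that the bias function $B_q(\epsilon) = \epsilon \sum_{n=0}^\infty q_n (1-\epsilon)^n$ satisfies $$B_q(\epsilon) = O\left(e^{-c/\epsilon}\right) \quad \text{as } \epsilon \to 0^+.$$
   Context: Fair duel problem: two duellists $X$ and $Y$ shoot at each other, one at a time; a sequence $q = (q_n)_{n\ge 0}$ with values in $\{-1,+1\}$ (an ordering) specifies whose turn it is at time $n$ ($q_n = +1$: $X$ shoots; $q_n=-1$: $Y$ shoots). Shots are independent, and each shot kills its target with probability $\epsilon \in (0,1)$; the duel ends at the first hit. The bias of $q$ is $B_q(\epsilon) := \mathbb{P}\{X \text{ survives}\} - \mathbb{P}\{Y \text{ survives}\}$, which equals $\epsilon \sum_{n=0}^\infty q_n (1-\epsilon)^n$. *)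

theory Defs
  imports "HOL-Probability.Probability"
begin

text \<open>
  An outcome \<open>\<omega>\<close> of the shots says for each time \<open>n\<close> whether the shot fired at time \<open>n\<close> would hit.
  The duel stops at the first hit, so later entries of \<open>\<omega>\<close> are irrelevant.
\<close>

definition shots :: "real \<Rightarrow> (nat \<Rightarrow> bool) measure" where
  "shots \<epsilon> = (\<Pi>\<^sub>M n\<in>UNIV. measure_pmf (bernoulli_pmf \<epsilon>))"

definition first_hit :: "(nat \<Rightarrow> bool) \<Rightarrow> nat \<Rightarrow> bool" where
  "first_hit \<omega> n \<longleftrightarrow> \<omega> n \<and> (\<forall>m<n. \<not> \<omega> m)"

text \<open>\<open>q n = 1\<close> means that \<open>X\<close> shoots at time \<open>n\<close>, so \<open>X\<close> dies iff the first hit is at an \<open>n\<close> with \<open>q n = -1\<close>.\<close>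

definition X_survives :: "(nat \<Rightarrow> real) \<Rightarrow> (nat \<Rightarrow> bool) \<Rightarrow> bool" where
  "X_survives q \<omega> \<longleftrightarrow> \<not> (\<exists>n. first_hit \<omega> n \<and> q n = -1)"

definition Y_survives :: "(nat \<Rightarrow> real) \<Rightarrow> (nat \<Rightarrow> bool) \<Rightarrow> bool" where
  "Y_survives q \<omega> \<longleftrightarrow> \<not> (\<exists>n. first_hit \<omega> n \<and> q n = 1)"

definition bias :: "(nat \<Rightarrow> real) \<Rightarrow> real \<Rightarrow> real" where
  "bias q \<epsilon> = \<P>(\<omega> in shots \<epsilon>. X_survives q \<omega>) - \<P>(\<omega> in shots \<epsilon>. Y_survives q \<omega>)"

lemma prob_space_shots: "prob_space (shots \<epsilon>)"
  unfolding shots_def by (intro prob_space_PiM prob_space_measure_pmf)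

lemma space_shots: "space (shots \<epsilon>) = UNIV"
  by (auto simp: shots_def space_PiM)

lemma first_hit_eq_emb:
  "{\<omega>. first_hit \<omega> n} = prod_emb UNIV (\<lambda>_. measure_pmf (bernoulli_pmf \<epsilon>)) {..n}
      (\<Pi>\<^sub>E i\<in>{..n}. if i = n then {True} else {False})"
  by (auto simp: prod_emb_def first_hit_def PiE_iff restrict_def extensional_def split: if_splits)

lemma first_hit_sets: "{\<omega>. first_hit \<omega> n} \<in> sets (shots \<epsilon>)"
  unfolding first_hit_eq_emb[of n \<epsilon>] shots_def by (rule sets_PiM_I) auto

lemma prob_first_hit:
  assumes "0 \<le> \<epsilon>" "\<epsilon> \<le> 1"
  shows "measure (shots \<epsilon>) {\<omega>. first_hit \<omega> n} = \<epsilon> * (1 - \<epsilon>) ^ n"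
proof -
  interpret product_prob_space "\<lambda>_::nat. measure_pmf (bernoulli_pmf \<epsilon>)" UNIV
    by unfold_locales
  have "measure (shots \<epsilon>) {\<omega>. first_hit \<omega> n} =
      (\<Prod>i\<le>n. measure (measure_pmf (bernoulli_pmf \<epsilon>)) (if i = n then {True} else {False}))"
    unfolding first_hit_eq_emb[of n \<epsilon>] shots_def by (rule measure_PiM_emb) auto
  also have "\<dots> = (\<Prod>i\<le>n. if i = n then \<epsilon> else 1 - \<epsilon>)"
    using assms by (intro prod.cong) (auto simp: measure_pmf_single)
  also have "\<dots> = \<epsilon> * (1 - \<epsilon>) ^ n"
    by (simp add: lessThan_Suc_atMost[symmetric])
  finally show ?thesis .
qed

lemma prob_no_first_hit:
  assumes "0 \<le> \<epsilon>" "\<epsilon> \<le> 1"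
  shows "(\<lambda>n. if P n then \<epsilon> * (1 - \<epsilon>) ^ n else 0) sums
    (1 - \<P>(\<omega> in shots \<epsilon>. \<not> (\<exists>n. first_hit \<omega> n \<and> P n)))"
proof -
  interpret prob_space "shots \<epsilon>" by (rule prob_space_shots)
  let ?A = "\<lambda>n. if P n then {\<omega>. first_hit \<omega> n} else {}"
  have sets: "range ?A \<subseteq> sets (shots \<epsilon>)" using first_hit_sets by auto
  have "disjoint_family ?A"
    unfolding disjoint_family_on_def first_hit_def by (auto, (meson linorder_neqE_nat)+)
  from finite_measure_UNION[OF sets this]
  have "(\<lambda>n. measure (shots \<epsilon>) (?A n)) sums measure (shots \<epsilon>) (\<Union>n. ?A n)" .
  moreover have "measure (shots \<epsilon>) (?A n) = (if P n then \<epsilon> * (1 - \<epsilon>) ^ n else 0)" for n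
    using prob_first_hit[OF assms] by simp
  moreover have "\<P>(\<omega> in shots \<epsilon>. \<not> (\<exists>n. first_hit \<omega> n \<and> P n)) = 1 - measure (shots \<epsilon>) (\<Union>n. ?A n)"
  proof -
    have "{\<omega> \<in> space (shots \<epsilon>). \<not> (\<exists>n. first_hit \<omega> n \<and> P n)} = space (shots \<epsilon>) - (\<Union>n. ?A n)"
      by (auto simp: space_shots split: if_splits)
    then show ?thesis using sets by (simp only:) (rule prob_compl, blast)
  qed
  ultimately show ?thesis by simp
qed

theorem bias_eq_series:
  assumes "\<And>n. q n \<in> {-1, 1}" "0 < \<epsilon>" "\<epsilon> < 1"
  shows "bias q \<epsilon> = \<epsilon> * (\<Sum>n. q n * (1 - \<epsilon>) ^ n)"
proof -
  let ?f = "\<lambda>s n. if q n = s then \<epsilon> * (1 - \<epsilon>) ^ n else 0"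
  have X: "?f (-1) sums (1 - \<P>(\<omega> in shots \<epsilon>. X_survives q \<omega>))"
    unfolding X_survives_def using assms by (intro prob_no_first_hit) auto
  have Y: "?f 1 sums (1 - \<P>(\<omega> in shots \<epsilon>. Y_survives q \<omega>))"
    unfolding Y_survives_def using assms by (intro prob_no_first_hit) auto
  have "(\<lambda>n. ?f 1 n - ?f (-1) n) sums bias q \<epsilon>"
    using sums_diff[OF Y X] by (simp add: bias_def)
  moreover have "?f 1 n - ?f (-1) n = \<epsilon> * (q n * (1 - \<epsilon>) ^ n)" for n
    using assms(1)[of n] by auto
  ultimately have "(\<lambda>n. \<epsilon> * (q n * (1 - \<epsilon>) ^ n)) sums bias q \<epsilon>" by simp
  then have "(\<lambda>n. q n * (1 - \<epsilon>) ^ n) sums (bias q \<epsilon> / \<epsilon>)"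
    using assms(2) sums_mult[of _ _ "1 / \<epsilon>"] by fastforce
  then show ?thesis using assms(2) by (simp add: sums_iff)
qed

end

theory Submission
  imports Defs "HOL-Complex_Analysis.Complex_Analysis"
begin

text \<open>
  The ordering is the output of a one-bit sigma-delta quantizer fed with the zero signal.
  Let \<open>h\<close> be a real sequence with \<open>h 0 = 0\<close> and \<open>\<Sum>n. \<bar>h n\<bar> \<le> 2\<close>, and put
  \<open>G x = 1 - (\<Sum>n. h n * x ^ n)\<close>. Greedy rounding produces signs \<open>q n\<close> and a bounded state
  \<open>\<bar>v n\<bar> \<le> 1\<close> with generating functions related by \<open>Q = - G * V\<close> (lemma \<open>noise_shaping\<close>). At
  \<open>x = 1 - \<epsilon>\<close> the state contributes at most \<open>\<bar>V x\<bar> \<le> 1 / \<epsilon>\<close>, and the factor \<open>\<epsilon>\<close> in the bias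
  cancels exactly this, so \<open>\<bar>bias q \<epsilon>\<bar> \<le> \<bar>G (1 - \<epsilon>)\<bar>\<close> (lemma \<open>bias_le_of_filter\<close>). The problem is now a
  linear one over the reals: find \<open>G\<close> with \<open>G 0 = 1\<close>, with its other coefficients of total size at
  most \<open>2\<close>, and exponentially small near \<open>1\<close>.

  Take \<open>G z = F z * exp (- a * z / (1 - z))\<close>. At \<open>z = 1 - \<epsilon>\<close> the exponential equals
  \<open>exp (a - a / \<epsilon>)\<close>. An essential singularity on the circle is the natural source of such decay: if
  \<open>log \<bar>G\<bar>\<close> were the Poisson integral of an integrable function on the circle, the radial decay would
  be slower than \<open>exp (- c / \<epsilon>)\<close> for every \<open>c > 0\<close>. The polynomial
  \<open>F\<close> has \<open>F 0 = 1\<close> and other coefficients of total size \<open>11 / 7 < 2\<close>, and it vanishes at \<open>1\<close> to order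
  four (lemma \<open>filter_polynomial\<close>). This zero tames the essential singularity: the second derivative of
  \<open>(z - 1) ^ 4 * (exp (- a * z / (1 - z)) - 1)\<close> is of size \<open>O(a)\<close> on the whole disc, so by Cauchy's
  inequality the coefficients are \<open>O(a / n\<^sup>2)\<close> and their total size is \<open>O(a)\<close> (lemma
  \<open>l1_series_singular_perturbation\<close>). Multiplication by the polynomial cofactor of \<open>(z - 1) ^ 4\<close> in \<open>F\<close>
  changes only the constant. For small \<open>a\<close> this fits into the remaining \<open>2 - 11 / 7 = 3 / 7\<close>.
\<close>

section \<open>Absolutely convergent power series\<close>

text \<open>
  This is the ball of radius \<open>B\<close> in the Wiener algebra of power series. The norm is used through upper
  bounds only, so that sums and products can be estimated without naming coefficient sequences.
\<close>

definition l1_series :: "(complex \<Rightarrow> complex) \<Rightarrow> real \<Rightarrow> bool" where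
  "l1_series f B \<longleftrightarrow> (\<exists>c. (\<forall>z. norm z < 1 \<longrightarrow> (\<lambda>n. c n * z ^ n) sums f z) \<and>
     summable (\<lambda>n. norm (c n)) \<and> (\<Sum>n. norm (c n)) \<le> B)"

lemma l1_series_add:
  assumes "l1_series f B" "l1_series g C"
  shows "l1_series (\<lambda>z. f z + g z) (B + C)"
proof -
  obtain b where b: "\<And>z. norm z < 1 \<Longrightarrow> (\<lambda>n. b n * z ^ n) sums f z"
    "summable (\<lambda>n. norm (b n))" "(\<Sum>n. norm (b n)) \<le> B"
    using assms(1) unfolding l1_series_def by blast
  obtain c where c: "\<And>z. norm z < 1 \<Longrightarrow> (\<lambda>n. c n * z ^ n) sums g z"
    "summable (\<lambda>n. norm (c n))" "(\<Sum>n. norm (c n)) \<le> C"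
    using assms(2) unfolding l1_series_def by blast
  have s: "summable (\<lambda>n. norm (b n + c n))"
    by (rule summable_comparison_test'[OF summable_add[OF b(2) c(2)]]) (simp add: norm_triangle_ineq)
  have "(\<Sum>n. norm (b n + c n)) \<le> (\<Sum>n. norm (b n) + norm (c n))"
    by (intro suminf_le s summable_add b c norm_triangle_ineq)
  also have "\<dots> \<le> B + C"
    using b c by (simp flip: suminf_add)
  finally have "(\<Sum>n. norm (b n + c n)) \<le> B + C" .
  moreover have "(\<lambda>n. (b n + c n) * z ^ n) sums (f z + g z)" if "norm z < 1" for z
    using sums_add[OF b(1)[OF that] c(1)[OF that]] by (simp add: algebra_simps)
  ultimately show ?thesis
    unfolding l1_series_def using s by (intro exI[of _ "\<lambda>n. b n + c n"]) auto
qed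

lemma l1_series_cmult:
  assumes "l1_series f B"
  shows "l1_series (\<lambda>z. k * f z) (norm k * B)"
proof -
  obtain b where b: "\<And>z. norm z < 1 \<Longrightarrow> (\<lambda>n. b n * z ^ n) sums f z"
    "summable (\<lambda>n. norm (b n))" "(\<Sum>n. norm (b n)) \<le> B"
    using assms(1) unfolding l1_series_def by blast
  have "(\<lambda>n. k * b n * z ^ n) sums (k * f z)" if "norm z < 1" for z
    using sums_mult[OF b(1)[OF that], of k] by (simp add: algebra_simps)
  moreover have "summable (\<lambda>n. norm (k * b n))"
    using b(2) by (simp add: norm_mult summable_mult)
  moreover have "(\<Sum>n. norm (k * b n)) \<le> norm k * B"
    using b by (simp add: norm_mult suminf_mult mult_left_mono)
  ultimately show ?thesis
    unfolding l1_series_def by (intro exI[of _ "\<lambda>n. k * b n"]) auto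
qed

lemma l1_series_shift:
  assumes "l1_series f B"
  shows "l1_series (\<lambda>z. z * f z) B"
proof -
  obtain b where b: "\<And>z. norm z < 1 \<Longrightarrow> (\<lambda>n. b n * z ^ n) sums f z"
    "summable (\<lambda>n. norm (b n))" "(\<Sum>n. norm (b n)) \<le> B"
    using assms(1) unfolding l1_series_def by blast
  define c where "c n = (case n of 0 \<Rightarrow> 0 | Suc m \<Rightarrow> b m)" for n
  have c: "c 0 = 0" "\<And>n. c (Suc n) = b n" by (auto simp: c_def)
  have "(\<lambda>n. c n * z ^ n) sums (z * f z)" if "norm z < 1" for z
  proof -
    have "(\<lambda>n. c (Suc n) * z ^ Suc n) sums (z * f z)"
      using sums_mult[OF b(1)[OF that], of z] by (simp add: c algebra_simps)
    then show ?thesis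
      by (subst (asm) sums_Suc_iff) (simp add: c)
  qed
  moreover have "(\<lambda>n. norm (c n)) sums (\<Sum>n. norm (b n))"
  proof -
    have "(\<lambda>n. norm (c (Suc n))) sums (\<Sum>n. norm (b n))"
      using b(2) by (simp add: c summable_sums)
    then show ?thesis
      by (subst (asm) sums_Suc_iff) (simp add: c)
  qed
  ultimately show ?thesis
    unfolding l1_series_def using b(3) by (intro exI[of _ c]) (auto simp: sums_iff)
qed

lemma l1_series_one: "l1_series (\<lambda>z. 1) 1"
proof -
  define c where "c n = (if n = 0 then 1 else 0 :: complex)" for n :: nat
  have "(\<lambda>n. c n * z ^ n) sums 1" for z
    using sums_finite[of "{0}" "\<lambda>n. c n * z ^ n"] by (simp add: c_def)
  moreover have "(\<lambda>n. norm (c n)) sums 1"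
    using sums_finite[of "{0}" "\<lambda>n. norm (c n)"] by (simp add: c_def)
  ultimately show ?thesis
    unfolding l1_series_def by (intro exI[of _ c]) (auto simp: sums_iff)
qed

lemma l1_series_monomial: "l1_series (\<lambda>z. k * z ^ n) (norm k)"
proof -
  have "l1_series (\<lambda>z. z ^ n) 1"
    by (induction n) (simp_all add: l1_series_one l1_series_shift)
  from l1_series_cmult[OF this, of k] show ?thesis by simp
qed

text \<open>
  Multiplication by a polynomial is a bounded operator; the \<open>K\<close> constructed
  here is the sum of the absolute values of the coefficients of \<open>p\<close>.
\<close>

lemma l1_series_poly_mult:
  fixes p :: "complex poly"
  shows "\<exists>K\<ge>0. \<forall>f B. l1_series f B \<longrightarrow> l1_series (\<lambda>z. poly p z * f z) (K * B)"
proof (induction p)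
  case 0
  have "l1_series (\<lambda>z. 0) 0"
    using l1_series_cmult[OF l1_series_one, of 0] by simp
  then show ?case by (intro exI[of _ 0]) simp
next
  case (pCons a p)
  then obtain K where K: "K \<ge> 0"
    "\<And>f B. l1_series f B \<Longrightarrow> l1_series (\<lambda>z. poly p z * f z) (K * B)"
    by blast
  have "l1_series (\<lambda>z. poly (pCons a p) z * f z) ((norm a + K) * B)" if "l1_series f B" for f B
    using l1_series_add[OF l1_series_cmult[OF that, of a] l1_series_shift[OF K(2)[OF that]]]
    by (simp add: algebra_simps)
  then show ?case using K(1) by (intro exI[of _ "norm a + K"]) auto
qed

section \<open>Coefficient bounds from a bounded second derivative\<close>

lemma higher_deriv_Suc_has_derivative:
  assumes "\<And>z. z \<in> ball 0 1 \<Longrightarrow> (f has_field_derivative f' z) (at z)"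
    and "f' holomorphic_on ball 0 1"
  shows "(deriv ^^ Suc n) f 0 = (deriv ^^ n) f' (0::complex)"
proof -
  have "f holomorphic_on ball 0 1"
    unfolding holomorphic_on_open[OF open_ball] using assms(1) by blast
  then have "deriv f holomorphic_on ball 0 1"
    by (intro holomorphic_deriv) auto
  then have "(deriv ^^ n) (deriv f) 0 = (deriv ^^ n) f' 0"
    using assms by (intro higher_deriv_transform_within_open[where S = "ball 0 1"])
      (auto intro: DERIV_imp_deriv)
  then show ?thesis by (simp add: funpow_Suc_right del: funpow.simps)
qed

text \<open>
  \<open>f\<close> need not extend continuously to the closed disc, so Cauchy's inequality is applied on circles of
  radius \<open>r < 1\<close> and then \<open>r\<close> tends to \<open>1\<close>.
\<close>

lemma Cauchy_inequality_unit_ball: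
  assumes "f holomorphic_on ball 0 1" and "\<And>z. norm z < 1 \<Longrightarrow> norm (f z) \<le> M"
  shows "norm ((deriv ^^ n) f (0::complex)) \<le> fact n * M"
proof -
  have "norm ((deriv ^^ n) f 0) * r ^ n \<le> fact n * M" if "r \<in> {0<..<1}" for r
  proof -
    have "norm ((deriv ^^ n) f 0) \<le> fact n * M / r ^ n"
    proof (rule Cauchy_inequality)
      show "f holomorphic_on ball 0 r"
        using that by (intro holomorphic_on_subset[OF assms(1)]) auto
      show "continuous_on (cball 0 r) f"
        using that by (intro holomorphic_on_imp_continuous_on holomorphic_on_subset[OF assms(1)]) auto
    qed (use that assms(2) in auto)
    then show ?thesis using that by (simp add: field_simps)
  qed
  then have "\<forall>\<^sub>F r in at_left 1. norm ((deriv ^^ n) f 0) * r ^ n \<le> fact n * M"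
    using eventually_at_left_real[of 0 1] by (auto elim: eventually_mono)
  moreover have "((\<lambda>r. norm ((deriv ^^ n) f 0) * r ^ n) \<longlongrightarrow> norm ((deriv ^^ n) f 0) * 1 ^ n) (at_left (1::real))"
    by (intro tendsto_intros)
  ultimately show ?thesis
    using tendsto_upperbound by (fastforce simp: trivial_limit_at_left_real)
qed

text \<open>
  Cauchy's inequality for \<open>f''\<close> bounds the coefficient of \<open>z ^ (n + 2)\<close> by \<open>M / ((n + 1) * (n + 2))\<close>, and these
  bounds telescope to \<open>M\<close>. One derivative would give only the divergent bound \<open>M / n\<close>; this is what
  dictates a zero of order four below, since each derivative of the exponential costs
  \<open>1 / (1 - z)\<^sup>2\<close>.
\<close>

lemma l1_series_of_second_derivative:
  assumes f': "\<And>z. norm z < 1 \<Longrightarrow> (f has_field_derivative f' z) (at z)"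
    and f'': "\<And>z. norm z < 1 \<Longrightarrow> (f' has_field_derivative f'' z) (at z)"
    and M: "\<And>z. norm z < 1 \<Longrightarrow> norm (f'' z) \<le> M"
    and hol: "f'' holomorphic_on ball 0 1"
  shows "l1_series f (norm (f 0) + norm (f' 0) + M)"
proof -
  have hol': "f' holomorphic_on ball 0 1" and holf: "f holomorphic_on ball 0 1"
    unfolding holomorphic_on_open[OF open_ball] using f' f'' by (metis mem_ball_0)+
  define c where "c n = (deriv ^^ n) f 0 / fact n" for n
  have sums: "(\<lambda>n. c n * z ^ n) sums f z" if "norm z < 1" for z
    using holomorphic_power_series[OF holf, of z] that by (simp add: c_def)
  have c01: "c 0 = f 0" "c 1 = f' 0"
    using DERIV_imp_deriv[OF f'[of 0]] by (simp_all add: c_def)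
  have bound: "norm (c (n + 2)) \<le> M * (1 / real (n + 1) - 1 / real (Suc n + 1))" for n
  proof -
    have "(deriv ^^ (n + 2)) f 0 = (deriv ^^ Suc n) f' 0"
      using higher_deriv_Suc_has_derivative[of f f' "Suc n"] f' hol' by simp
    also have "\<dots> = (deriv ^^ n) f'' 0"
      using f'' hol by (intro higher_deriv_Suc_has_derivative) auto
    finally have "norm (c (n + 2)) = norm ((deriv ^^ n) f'' 0) / fact (n + 2)"
      by (simp only: c_def norm_divide norm_fact)
    also have "\<dots> \<le> fact n * M / fact (n + 2)"
      by (intro divide_right_mono Cauchy_inequality_unit_ball hol M) auto
    also have "fact (n + 2) = fact n * (real (n + 1) * real (n + 2))"
      by (simp add: algebra_simps)
    also have "fact n * M / \<dots> = M * (1 / real (n + 1) - 1 / real (Suc n + 1))"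
      by (simp add: divide_simps)
    finally show ?thesis .
  qed
  have "(\<lambda>n. 1 / real (n + 1) - 1 / real (Suc n + 1)) sums (1 / real (0 + 1) - 0)"
    by (rule telescope_sums'[of "\<lambda>n. 1 / real (n + 1)"]) real_asymp
  then have tel: "(\<lambda>n. M * (1 / real (n + 1) - 1 / real (Suc n + 1))) sums M"
    using sums_mult[of _ 1 M] by simp
  have s2: "summable (\<lambda>n. norm (c (n + 2)))"
    using bound by (intro summable_comparison_test'[OF sums_summable[OF tel]]) auto
  then have s: "summable (\<lambda>n. norm (c n))"
    by (rule iffD1[OF summable_iff_shift])
  have "(\<Sum>n. norm (c n)) = (\<Sum>n. norm (c (n + 2))) + (\<Sum>n<2. norm (c n))"
    by (rule suminf_split_initial_segment[OF s])
  also have "(\<Sum>n<2. norm (c n)) = norm (f 0) + norm (f' 0)"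
    using c01 by (simp add: numeral_2_eq_2)
  also have "(\<Sum>n. norm (c (n + 2))) \<le> M"
    using suminf_le[OF bound s2 sums_summable[OF tel]] tel by (simp add: sums_iff)
  finally have "(\<Sum>n. norm (c n)) \<le> norm (f 0) + norm (f' 0) + M" by linarith
  then show ?thesis
    unfolding l1_series_def using s sums by (intro exI[of _ c]) auto
qed

section \<open>The singular factor\<close>

text \<open>
  Only an upper bound on \<open>Re w\<close> is available below: the exponent tends to \<open>-\<infinity>\<close> along the radius to \<open>1\<close>,
  so a factor \<open>exp \<bar>Re w\<bar>\<close> would be useless.
\<close>

lemma norm_exp_minus_1_le:
  fixes w :: complex
  assumes "Re w \<le> b" "0 \<le> b"
  shows "norm (exp w - 1) \<le> exp b * norm w"
proof -
  have "norm (exp w - exp 0) \<le> exp b * norm (w - 0)"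
  proof (rule field_differentiable_bound[where S = "{z. Re z \<le> b}" and f' = exp])
    show "convex {z. Re z \<le> b}" by (rule convex_halfspace_Re_le)
  qed (use assms in \<open>auto intro: DERIV_subset[OF DERIV_exp]\<close>)
  then show ?thesis by simp
qed

text \<open>
  On the unit disc \<open>Re (1 / (1 - z)) \<ge> 1 / 2\<close>, so the exponent \<open>w = a - a / (1 - z)\<close> has real part at most
  \<open>a / 2\<close> and the exponential is bounded although \<open>1\<close> is an essential singularity. In the second
  derivative every power of \<open>1 / (1 - z)\<close> is absorbed by the factor \<open>(z - 1) ^ 4\<close>, and every term keeps a
  factor \<open>a\<close>, either from differentiating the exponent or from \<open>\<bar>exp w - 1\<bar> \<le> 2 * \<bar>w\<bar>\<close>.
\<close>

lemma l1_series_singular_perturbation: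
  assumes a: "0 < a" "a \<le> 1"
  shows "l1_series (\<lambda>z. (z - 1) ^ 4 * (exp (- (of_real a * z / (1 - z))) - 1)) (75 * a)"
proof -
  define E where "E z = exp (- (of_real a * z / (1 - z)))" for z :: complex
  define T where "T z = (z - 1) ^ 4 * (E z - 1)" for z
  define T' where "T' z = 4 * (z - 1) ^ 3 * (E z - 1) - of_real a * (z - 1) ^ 2 * E z" for z
  define T'' where "T'' z = 12 * (z - 1) ^ 2 * (E z - 1) - 6 * of_real a * (z - 1) * E z
    + of_real a ^ 2 * E z" for z
  have ne: "z \<noteq> 1" if "norm z < 1" for z :: complex using that by auto
  have dE: "(E has_field_derivative - of_real a / (z - 1) ^ 2 * E z) (at z)" if "norm z < 1" for z
    unfolding E_def using ne[OF that]
    by (auto intro!: derivative_eq_intros simp: field_simps power2_eq_square)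
  have dT: "(T has_field_derivative T' z) (at z)" if "norm z < 1" for z
    unfolding T_def T'_def using ne[OF that]
    by (auto intro!: derivative_eq_intros dE that simp: divide_simps) (simp add: algebra_simps power_numeral_reduce)
  have dT': "(T' has_field_derivative T'' z) (at z)" if "norm z < 1" for z
    unfolding T'_def T''_def using ne[OF that]
    by (auto intro!: derivative_eq_intros dE that simp: divide_simps) (simp add: algebra_simps power_numeral_reduce)
  have hol: "T'' holomorphic_on ball 0 1"
    unfolding T''_def E_def by (intro holomorphic_intros) auto
  have bound: "norm (T'' z) \<le> 74 * a" if z: "norm z < 1" for z
  proof -
    let ?w = "- (of_real a * z / (1 - z))"
    have n1: "norm (z - 1) \<le> 2"
      using norm_triangle_ineq4[of z 1] z by simp
    \<comment> \<open>The disc is mapped by \<open>z \<mapsto> 1 / (1 - z)\<close> to the half-plane \<open>Re > 1 / 2\<close>.\<close>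
    have "norm (1 - z) ^ 2 \<le> 2 * (1 - Re z)"
    proof -
      have "(Re z)\<^sup>2 + (Im z)\<^sup>2 \<le> 1"
        using z by (metis cmod_power2 norm_ge_zero power_le_one order_less_imp_le)
      then show ?thesis
        unfolding cmod_power2 by (simp add: power2_eq_square algebra_simps)
    qed
    then have "1 / 2 \<le> Re (1 / (1 - z))"
      using ne[OF z] by (simp add: Re_divide' field_simps)
    then have "a * (1 / 2) \<le> a * Re (1 / (1 - z))"
      using a by (intro mult_left_mono) auto
    moreover have "?w = of_real a - of_real a * (1 / (1 - z))"
      using ne[OF z] by (simp add: field_simps)
    then have "Re ?w = a - a * Re (1 / (1 - z))"
      by (simp only: minus_complex.sel times_complex.sel Re_complex_of_real Im_complex_of_real
          mult_zero_left diff_zero)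
    ultimately have "Re ?w \<le> a / 2" by linarith
    then have re: "Re ?w \<le> 1 / 2" using a by linarith
    have e2: "exp (1/2::real) \<le> 2" using real_exp_bound_lemma[of "1/2"] by simp
    have E: "norm (E z) \<le> 2"
      using re e2 unfolding E_def norm_exp_eq_Re by (meson exp_le_cancel_iff order_trans)
    have "norm (E z - 1) \<le> exp (1/2) * norm ?w"
      unfolding E_def using re by (intro norm_exp_minus_1_le) auto
    also have "\<dots> \<le> 2 * norm ?w" using e2 by (intro mult_right_mono) auto
    also have "norm ?w = a * norm z / norm (z - 1)"
      using a by (simp add: norm_mult norm_divide norm_minus_commute)
    finally have "norm (z - 1) * norm (E z - 1) \<le> 2 * (a * norm z)"
      using ne[OF z] by (simp add: field_simps)
    also have "\<dots> \<le> 2 * (a * 1)" using a z by (intro mult_left_mono) auto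
    finally have "norm (z - 1) * norm (E z - 1) \<le> 2 * a" by simp
    then have "norm (z - 1) * (norm (z - 1) * norm (E z - 1)) \<le> 2 * (2 * a)"
      by (rule mult_mono[OF n1]) auto
    then have t1: "norm (12 * (z - 1) ^ 2 * (E z - 1)) \<le> 48 * a"
      by (simp add: norm_mult norm_power power2_eq_square mult.assoc)
    have "norm (z - 1) * norm (E z) \<le> 2 * 2" using n1 E by (intro mult_mono) auto
    then have "a * (norm (z - 1) * norm (E z)) \<le> a * 4" using a by (intro mult_left_mono) auto
    moreover have "norm (6 * of_real a * (z - 1) * E z) = 6 * \<bar>a\<bar> * norm (z - 1) * norm (E z)"
      by (simp only: norm_mult norm_of_real norm_numeral)
    ultimately have t2: "norm (6 * of_real a * (z - 1) * E z) \<le> 24 * a"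
      using a by (simp only: abs_of_pos mult.assoc)
    have "a * a * norm (E z) \<le> a * 1 * 2" using a E by (intro mult_mono) auto
    then have t3: "norm (of_real a ^ 2 * E z) \<le> 2 * a"
      using a by (simp add: norm_mult norm_power power2_eq_square)
    have "norm (T'' z) \<le> norm (12 * (z - 1) ^ 2 * (E z - 1)) + norm (6 * of_real a * (z - 1) * E z)
      + norm (of_real a ^ 2 * E z)"
      unfolding T''_def by (meson norm_triangle_ineq norm_triangle_ineq4 add_right_mono order_trans)
    then show ?thesis using t1 t2 t3 by linarith
  qed
  have "l1_series T (norm (T 0) + norm (T' 0) + 74 * a)"
    using dT dT' bound hol by (rule l1_series_of_second_derivative)
  moreover have "norm (T 0) + norm (T' 0) + 74 * a = 75 * a"
    using a by (simp add: T_def T'_def E_def)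
  ultimately have "l1_series T (75 * a)" by simp
  then show ?thesis unfolding T_def[abs_def] E_def .
qed

section \<open>The polynomial factor\<close>

lemma power_taylor_at_1:
  "\<exists>r. \<forall>z::complex. z ^ n = 1 + of_nat n * (z - 1) + of_nat (n choose 2) * (z - 1) ^ 2
     + of_nat (n choose 3) * (z - 1) ^ 3 + (z - 1) ^ 4 * poly r z"
proof (induction n)
  case 0
  then show ?case by (intro exI[of _ 0]) (simp add: numeral_eq_Suc)
next
  case (Suc n)
  then obtain r where r: "\<And>z::complex. z ^ n = 1 + of_nat n * (z - 1) + of_nat (n choose 2) * (z - 1) ^ 2
     + of_nat (n choose 3) * (z - 1) ^ 3 + (z - 1) ^ 4 * poly r z"
    by blast
  have "Suc n choose 2 = n + (n choose 2)" "Suc n choose 3 = (n choose 2) + (n choose 3)"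
    by (simp_all add: numeral_eq_Suc)
  then show ?case
    by (intro exI[of _ "pCons (of_nat (n choose 3)) r"])
      (simp add: r algebra_simps power_numeral_reduce)
qed

text \<open>
  A polynomial \<open>1 - (\<Sum>i. w i * z ^ n i)\<close> with four exponents vanishes to order at least four at \<open>1\<close> exactly if
  \<open>\<Sum>i. w i * p (n i) = p 0\<close> for all polynomials \<open>p\<close> of degree at most three, that is, if the \<open>w i\<close> are the
  Lagrange weights \<open>\<Prod>j\<noteq>i. n j / (n j - n i)\<close> for extrapolation to \<open>0\<close>. Widely spread nodes
  keep the weights small; \<open>1, 8, 28, 36\<close> give the total size \<open>165 / 105 = 11 / 7\<close>.
\<close>

lemma filter_polynomial:
  "\<exists>r. \<forall>z::complex. 1 - (128 / 105 * z + (- 27 / 105) * z ^ 8 + 7 / 105 * z ^ 28 + (- 3 / 105) * z ^ 36)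
    = (z - 1) ^ 4 * poly r z"
proof -
  have ch: "8 choose 2 = (28::nat)" "8 choose 3 = (56::nat)" "28 choose 2 = (378::nat)"
    "28 choose 3 = (3276::nat)" "36 choose 2 = (630::nat)" "36 choose 3 = (7140::nat)"
    by (simp_all add: numeral_eq_Suc)
  obtain r8 where r8: "\<And>z::complex. z ^ 8 = 1 + 8 * (z - 1) + 28 * (z - 1) ^ 2 + 56 * (z - 1) ^ 3
      + (z - 1) ^ 4 * poly r8 z"
    using power_taylor_at_1[of 8] by (auto simp: ch)
  obtain r28 where r28: "\<And>z::complex. z ^ 28 = 1 + 28 * (z - 1) + 378 * (z - 1) ^ 2 + 3276 * (z - 1) ^ 3
      + (z - 1) ^ 4 * poly r28 z"
    using power_taylor_at_1[of 28] by (auto simp: ch)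
  obtain r36 where r36: "\<And>z::complex. z ^ 36 = 1 + 36 * (z - 1) + 630 * (z - 1) ^ 2 + 7140 * (z - 1) ^ 3
      + (z - 1) ^ 4 * poly r36 z"
    using power_taylor_at_1[of 36] by (auto simp: ch)
  have "1 - (128 / 105 * z + (- 27 / 105) * z ^ 8 + 7 / 105 * z ^ 28 + (- 3 / 105) * z ^ 36)
    = (z - 1) ^ 4 * poly (smult (27 / 105) r8 - smult (7 / 105) r28 + smult (3 / 105) r36) z"
    for z :: complex
  proof -
    define u where "u = z - 1"
    have z: "z = 1 + u" by (simp add: u_def)
    show ?thesis
      unfolding r8[of z] r28[of z] r36[of z] u_def[symmetric] by (simp add: z field_simps)
  qed
  then show ?thesis by blast
qed

section \<open>Noise shaping\<close>

text \<open>
  The sum \<open>s\<close> is the filtered past; the sign subtracted from it is the next output of the quantizer.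
\<close>

fun quantizer_state :: "(nat \<Rightarrow> real) \<Rightarrow> nat \<Rightarrow> real" where
  "quantizer_state h n = (let s = \<Sum>k<n. h (n - k) * quantizer_state h k in
     if s \<ge> 0 then s - 1 else s + 1)"

declare quantizer_state.simps [simp del]

text \<open>
  The bound on the state is self-reproducing: if the earlier states are at most \<open>1\<close> in absolute value, the
  filtered past lies in \<open>[-2, 2]\<close>, and subtracting its sign returns it to \<open>[-1, 1]\<close>.
\<close>

lemma noise_shaping:
  fixes h :: "nat \<Rightarrow> real"
  assumes h0: "h 0 = 0" and sh: "summable (\<lambda>n. \<bar>h n\<bar>)" and h2: "(\<Sum>n. \<bar>h n\<bar>) \<le> 2"
  obtains q v :: "nat \<Rightarrow> real" where "\<And>n. q n \<in> {-1, 1}" "\<And>n. \<bar>v n\<bar> \<le> 1"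
    "\<And>n. q n = (\<Sum>k\<le>n. h k * v (n - k)) - v n"
proof
  define v where "v = quantizer_state h"
  define q where "q n = (if (\<Sum>k<n. h (n - k) * v k) \<ge> 0 then 1 else -1 :: real)" for n
  have v: "v n = (\<Sum>k<n. h (n - k) * v k) - q n" for n
    unfolding v_def q_def by (subst quantizer_state.simps) (simp add: Let_def)
  show "q n \<in> {-1, 1}" for n by (simp add: q_def)
  show "\<bar>v n\<bar> \<le> 1" for n
  proof (induction n rule: less_induct)
    case (less n)
    have "\<bar>\<Sum>k<n. h (n - k) * v k\<bar> \<le> (\<Sum>k<n. \<bar>h (n - k)\<bar> * 1)"
      by (intro order_trans[OF sum_abs] sum_mono) (auto simp: abs_mult intro!: mult_left_le less)
    also have "\<dots> = (\<Sum>k\<in>{1..n}. \<bar>h k\<bar>)"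
      by (rule sum.reindex_bij_witness[of _ "\<lambda>k. n - k" "\<lambda>k. n - k"]) auto
    also have "\<dots> \<le> (\<Sum>n. \<bar>h n\<bar>)" by (rule sum_le_suminf[OF sh]) auto
    finally have "\<bar>\<Sum>k<n. h (n - k) * v k\<bar> \<le> 2" using h2 by linarith
    then show ?case by (subst v) (auto simp: q_def)
  qed
  show "q n = (\<Sum>k\<le>n. h k * v (n - k)) - v n" for n
  proof -
    have "(\<Sum>k\<le>n. h k * v (n - k)) = (\<Sum>k\<le>n. h (n - k) * v k)"
      by (rule sum.reindex_bij_witness[of _ "\<lambda>k. n - k" "\<lambda>k. n - k"]) auto
    also have "\<dots> = (\<Sum>k<n. h (n - k) * v k)"
      by (simp add: h0 flip: lessThan_Suc_atMost)
    finally show ?thesis using v[of n] by simp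
  qed
qed

text \<open>
  In terms of generating functions at \<open>x = 1 - \<epsilon>\<close>, noise shaping reads \<open>Q = (H - 1) * V\<close> with
  \<open>\<bar>V\<bar> \<le> (\<Sum>n. x ^ n) = 1 / \<epsilon>\<close>, and the bias is \<open>\<epsilon> * Q\<close>.
\<close>

lemma bias_le_of_filter:
  fixes h :: "nat \<Rightarrow> real"
  assumes h0: "h 0 = 0" and sh: "summable (\<lambda>n. \<bar>h n\<bar>)" and h2: "(\<Sum>n. \<bar>h n\<bar>) \<le> 2"
  obtains q :: "nat \<Rightarrow> real" where "\<And>n. q n \<in> {-1, 1}"
    "\<And>\<epsilon>. 0 < \<epsilon> \<Longrightarrow> \<epsilon> < 1 \<Longrightarrow> \<bar>bias q \<epsilon>\<bar> \<le> \<bar>1 - (\<Sum>n. h n * (1 - \<epsilon>) ^ n)\<bar>"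
proof -
  obtain q v :: "nat \<Rightarrow> real" where q: "\<And>n. q n \<in> {-1, 1}" and v: "\<And>n. \<bar>v n\<bar> \<le> 1"
    and qv: "\<And>n. q n = (\<Sum>k\<le>n. h k * v (n - k)) - v n"
    using noise_shaping[OF assms] by metis
  have "\<bar>bias q \<epsilon>\<bar> \<le> \<bar>1 - (\<Sum>n. h n * (1 - \<epsilon>) ^ n)\<bar>" if \<epsilon>: "0 < \<epsilon>" "\<epsilon> < 1" for \<epsilon>
  proof -
    define x where "x = 1 - \<epsilon>"
    have x: "0 < x" "x < 1" using \<epsilon> by (auto simp: x_def)
    have geo: "(\<lambda>n. x ^ n) sums (1 / (1 - x))" using x by (intro geometric_sums) auto
    have vx: "\<bar>v n * x ^ n\<bar> \<le> x ^ n" for n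
      using v[of n] x by (simp add: abs_mult mult_left_le_one_le)
    have hx: "\<bar>h n * x ^ n\<bar> \<le> \<bar>h n\<bar>" for n
      using x by (simp add: abs_mult mult_left_le power_le_one)
    have sv: "summable (\<lambda>n. norm (v n * x ^ n))"
      using vx by (intro summable_comparison_test'[OF sums_summable[OF geo]]) auto
    have shx: "summable (\<lambda>n. norm (h n * x ^ n))"
      using hx by (intro summable_comparison_test'[OF sh]) auto
    define V where "V = (\<Sum>n. v n * x ^ n)"
    define H where "H = (\<Sum>n. h n * x ^ n)"
    have "\<bar>V\<bar> \<le> (\<Sum>n. \<bar>v n * x ^ n\<bar>)"
      unfolding V_def using summable_rabs sv by simp
    also have "\<dots> \<le> (\<Sum>n. x ^ n)"
      using sv by (intro suminf_le vx sums_summable[OF geo]) auto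
    also have "\<dots> = 1 / \<epsilon>" using geo by (simp add: sums_iff x_def)
    finally have V: "\<bar>V\<bar> \<le> 1 / \<epsilon>" .
    have "(\<lambda>n. \<Sum>k\<le>n. (h k * x ^ k) * (v (n - k) * x ^ (n - k))) sums (H * V)"
      unfolding H_def V_def by (rule Cauchy_product_sums[OF shx sv])
    moreover have "(\<Sum>k\<le>n. (h k * x ^ k) * (v (n - k) * x ^ (n - k)))
        = (\<Sum>k\<le>n. h k * v (n - k)) * x ^ n" for n
      unfolding sum_distrib_right
    proof (rule sum.cong)
      fix k assume "k \<in> {..n}"
      then have "x ^ k * x ^ (n - k) = x ^ n" by (simp flip: power_add)
      then show "(h k * x ^ k) * (v (n - k) * x ^ (n - k)) = h k * v (n - k) * x ^ n"
        by (metis mult.assoc mult.left_commute)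
    qed simp
    moreover have "(\<lambda>n. v n * x ^ n) sums V"
      unfolding V_def using sv by (intro summable_sums summable_norm_cancel[OF sv])
    ultimately have "(\<lambda>n. (\<Sum>k\<le>n. h k * v (n - k)) * x ^ n - v n * x ^ n) sums (H * V - V)"
      by (intro sums_diff) auto
    then have "(\<lambda>n. q n * x ^ n) sums (H * V - V)"
      by (subst qv) (simp add: algebra_simps)
    then have "bias q \<epsilon> = \<epsilon> * (H * V - V)"
      using bias_eq_series[OF q \<epsilon>] by (simp add: sums_iff x_def)
    then have "bias q \<epsilon> = - ((1 - H) * (\<epsilon> * V))" by (simp add: algebra_simps)
    moreover have "\<bar>\<epsilon> * V\<bar> \<le> 1" using V \<epsilon> by (simp add: abs_mult field_simps)
    ultimately show ?thesis
      unfolding H_def x_def by (simp add: abs_mult mult_left_le)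
  qed
  with q show ?thesis by (rule that)
qed

section \<open>An exponentially fair ordering\<close>

text \<open>
  The quantizer requires real coefficients. Taking real parts does not increase absolute values and does
  not disturb the real part of the sum on the real axis.
\<close>

lemma l1_series_real_coefficients:
  assumes "l1_series f B" and "f 0 = 0"
  obtains h :: "nat \<Rightarrow> real" where "h 0 = 0" "summable (\<lambda>n. \<bar>h n\<bar>)" "(\<Sum>n. \<bar>h n\<bar>) \<le> B"
    "\<And>x. \<bar>x\<bar> < 1 \<Longrightarrow> (\<Sum>n. h n * x ^ n) = Re (f (of_real x))"
proof -
  obtain c where c: "\<And>z. norm z < 1 \<Longrightarrow> (\<lambda>n. c n * z ^ n) sums f z"
    "summable (\<lambda>n. norm (c n))" "(\<Sum>n. norm (c n)) \<le> B"
    using assms(1) unfolding l1_series_def by blast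
  have "c 0 = f 0"
    using c(1)[of 0] by (simp add: powser_sums_zero_iff)
  then have "Re (c 0) = 0" using assms(2) by simp
  moreover have s: "summable (\<lambda>n. \<bar>Re (c n)\<bar>)"
    by (rule summable_comparison_test'[OF c(2)]) (simp add: abs_Re_le_cmod)
  moreover have "(\<Sum>n. \<bar>Re (c n)\<bar>) \<le> B"
    using suminf_le[OF abs_Re_le_cmod s c(2)] c(3) by linarith
  moreover have "(\<Sum>n. Re (c n) * x ^ n) = Re (f (of_real x))" if "\<bar>x\<bar> < 1" for x
  proof -
    have "(\<lambda>n. Re (c n * of_real x ^ n)) sums Re (f (of_real x))"
      using c(1)[of "of_real x"] that by (intro sums_Re) simp
    moreover have "Re (c n * of_real x ^ n) = Re (c n) * x ^ n" for n
      by (simp flip: of_real_power)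
    ultimately show ?thesis by (simp add: sums_iff)
  qed
  ultimately show ?thesis by (rule that)
qed

theorem mainTheorem2:
  "\<exists>c::real. c > 0 \<and> (\<exists>q::nat \<Rightarrow> real. (\<forall>n. q n \<in> {-1, 1}) \<and>
     bias q \<in> O[at_right 0](\<lambda>\<epsilon>. exp (- c / \<epsilon>)))"
proof -
  define P :: "complex \<Rightarrow> complex" where
    "P z = 128 / 105 * z + (- 27 / 105) * z ^ 8 + 7 / 105 * z ^ 28 + (- 3 / 105) * z ^ 36" for z
  obtain r where r: "\<And>z. 1 - P z = (z - 1) ^ 4 * poly r z"
    unfolding P_def using filter_polynomial by blast
  have P: "l1_series P (11 / 7)"
    using l1_series_add[OF l1_series_add[OF l1_series_add[OF l1_series_monomial[of "128/105" 1, unfolded power_one_right]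
      l1_series_monomial[of "- 27/105" 8]] l1_series_monomial[of "7/105" 28]] l1_series_monomial[of "- 3/105" 36]]
    unfolding P_def by simp
  obtain K where K: "K \<ge> 0"
    "\<And>f B. l1_series f B \<Longrightarrow> l1_series (\<lambda>z. poly (- r) z * f z) (K * B)"
    using l1_series_poly_mult[of "- r"] by blast
  \<comment> \<open>Chosen such that \<open>75 * a * K \<le> 3 / 7\<close>, the slack between \<open>11 / 7\<close> and \<open>2\<close>.\<close>
  define a where "a = 1 / (175 * (K + 1))"
  have a: "0 < a" "a \<le> 1" "K * (75 * a) \<le> 3 / 7"
    using K(1) by (auto simp: a_def field_simps)
  define E :: "complex \<Rightarrow> complex" where "E z = exp (- (of_real a * z / (1 - z)))" for z
  define f where "f z = P z + poly (- r) z * ((z - 1) ^ 4 * (E z - 1))" for z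
  have "l1_series f (11 / 7 + K * (75 * a))"
    unfolding f_def E_def by (intro l1_series_add P K(2) l1_series_singular_perturbation a)
  moreover have "f 0 = 0" by (simp add: f_def P_def E_def)
  ultimately obtain h where h: "h 0 = 0" "summable (\<lambda>n. \<bar>h n\<bar>)" "(\<Sum>n. \<bar>h n\<bar>) \<le> 11 / 7 + K * (75 * a)"
    "\<And>x. \<bar>x\<bar> < 1 \<Longrightarrow> (\<Sum>n. h n * x ^ n) = Re (f (of_real x))"
    by (rule l1_series_real_coefficients) blast
  have "(\<Sum>n. \<bar>h n\<bar>) \<le> 2" using h(3) a(3) by linarith
  then obtain q :: "nat \<Rightarrow> real" where q: "\<And>n. q n \<in> {-1, 1}"
    "\<And>\<epsilon>. 0 < \<epsilon> \<Longrightarrow> \<epsilon> < 1 \<Longrightarrow> \<bar>bias q \<epsilon>\<bar> \<le> \<bar>1 - (\<Sum>n. h n * (1 - \<epsilon>) ^ n)\<bar>"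
    using bias_le_of_filter[OF h(1,2)] by metis
  have "\<bar>bias q \<epsilon>\<bar> \<le> (3 * exp a) * exp (- a / \<epsilon>)" if \<epsilon>: "0 < \<epsilon>" "\<epsilon> < 1" for \<epsilon>
  proof -
    define z :: complex where "z = of_real (1 - \<epsilon>)"
    have nz: "norm z \<le> 1" using \<epsilon> unfolding z_def norm_of_real by auto
    have "1 - f z = (1 - P z) + poly r z * (z - 1) ^ 4 * (E z - 1)"
      by (simp add: f_def)
    also have "\<dots> = (1 - P z) * E z" by (simp add: r algebra_simps)
    finally have f: "1 - f z = (1 - P z) * E z" .
    have pw: "norm (k * z ^ n) \<le> norm k" for k n
      using nz by (simp add: norm_mult norm_power mult_left_le power_le_one)
    have "norm (P z) \<le> norm (128 / 105::complex) + norm (- 27 / 105::complex)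
        + norm (7 / 105::complex) + norm (- 3 / 105::complex)"
      unfolding P_def by (intro norm_triangle_le add_mono pw pw[of _ 1, unfolded power_one_right])
    then have P3: "norm (1 - P z) \<le> 3"
      using norm_triangle_ineq4[of 1 "P z"] by simp
    have "- (of_real a * z / (1 - z)) = of_real (a - a / \<epsilon>)"
      using \<epsilon> by (simp add: z_def field_simps)
    then have E: "norm (E z) = exp a * exp (- a / \<epsilon>)"
      unfolding E_def by (simp add: norm_exp_eq_Re flip: exp_add)
    have "\<bar>bias q \<epsilon>\<bar> \<le> \<bar>Re (1 - f z)\<bar>"
      using q(2)[OF \<epsilon>] h(4)[of "1 - \<epsilon>"] \<epsilon> by (simp add: z_def)
    also have "\<dots> \<le> norm (1 - f z)" by (rule abs_Re_le_cmod)
    also have "\<dots> \<le> 3 * norm (E z)"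
      unfolding f norm_mult using P3 by (intro mult_right_mono) auto
    finally show ?thesis unfolding E by simp
  qed
  then have "\<forall>\<^sub>F \<epsilon> in at_right 0. norm (bias q \<epsilon>) \<le> (3 * exp a) * norm (exp (- a / \<epsilon>))"
    using eventually_at_right_real[of 0 1] by (auto elim!: eventually_mono)
  then have "bias q \<in> O[at_right 0](\<lambda>\<epsilon>. exp (- a / \<epsilon>))" by (rule bigoI)
  with a(1) q(1) show ?thesis by blast
qed

end
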